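(* Suppose Assumption 1 (stated in the context) holds. If $p_1>\alpha$ and $p_2>1$, then $\Gamma$ has no pure Nash equilibrium. Furthermore, there exists $\sigma_0=(\sigma^1_0,\sigma^2_0)\in\mathcal{S}_\Gamma$ such that $U_1(\sigma^1_0,\sigma^2_0)=U_2(\sigma^1_0,\sigma^2_0)=0$, $\operatorname{supp}(\sigma^1_0)=\{x^0,x^*\}$ and $\operatorname{supp}(\sigma^2_0)=\{\mu^0,\mu^{min}\}$. The corresponding probabilities are $$\sigma^1_{x^0}=1-\frac{1}{p_2},\quad \sigma^1_{x^*}=\frac{1}{p_2},\qquad \sigma^2_{\mu^0}=\frac{\alpha}{p_1},\quad \sigma^2_{\mu^{min}}=1-\frac{\alpha}{p_1}.$$ Here $x^0$ is the action of not sending any flow, $x^*$ is a maximum flow with minimum transportation cost satisfying the condition in Assumption 1, $\mu^0$ is the action of not attacking any edge, and $\mu^{min}$ is the action that disrupts all the edges of a min-cut.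
   Context: Network. $\mathcal{G}=(\mathcal{V},\mathcal{E})$ is a capacitated directed graph with source node $s$ and destination node $t$. Each edge $(i,j)\in\mathcal{E}$ has a capacity $c_{ij}\in\mathbb{R}^+$ and a cost $b_{ij}\in\mathbb{R}^+$ of transporting one unit of flow through it ($\mathbb{R}^+$ is the set of nonnegative reals). Flow can only enter the network from $s$ and leave from $t$. A flow is a function $x:\mathcal{E}\to\mathbb{R}^+$, $x_{ij}=x((i,j))$; it is feasible if $\sum_{(j,i)\in\mathcal{E}}x_{ji}=\sum_{(i,j)\in\mathcal{E}}x_{ij}$ for all $i\in\mathcal{V}\setminus\{s,t\}$ and $0\le x_{ij}\le c_{ij}$ for all $(i,j)\in\mathcal{E}$. $\mathcal{F}$ is the set of feasible flows. $\Lambda$ is the set of all loops and $s$-$t$ paths of the network, $\Lambda_{path}$ the set of all $s$-$t$ paths, and $x_\lambda$ is the quantity of flow of $x$ sent through $\lambda\in\Lambda$, so that $x_{ij}=\sum_{\{\lambda\in\Lambda:(i,j)\in\lambda\}}x_\lambda$ for every edge. $F(x)=\sum_{\{i\in\mathcal{V}:(i,t)\in\mathcal{E}\}}x_{it}$ denotes the amount of flow passing from $s$ to $t$, and $C_1(x)=\sum_{(i,j)\in\mathcal{E}}b_{ij}x_{ij}$ is the transportation cost. $\Omega$ is the set of maximum flows with minimum transportation cost, i.e. the minimizers of $C_1$ over $\{x\in\mathcal{F}:F(x)\ge F(x')\ \forall x'\in\mathcal{F}\}$. An $s$-$t$ cut is a partition $\{S,T\}$ of $\mathcal{V}$ with $s\in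 S$, $t\in T$; its cut-set is $E(\{S,T\})=\{(i,j)\in\mathcal{E}:i\in S,\ j\notin S\}$ and its capacity is $\sum_{(i,j)\in E(\{S,T\})}c_{ij}$; a min-cut is an $s$-$t$ cut of minimum capacity, and its edges are those of its cut-set. Attacks. $\mathcal{A}=\{0,1\}^{\mathcal{E}}$; for $\mu\in\mathcal{A}$, $\mu_{ij}=1$ means edge $(i,j)$ is disrupted, and $C_2(\mu)=\sum_{(i,j)\in\mathcal{E}}c_{ij}\mu_{ij}$ is the cost of the attack. When flow $x$ and attack $\mu$ are chosen, the effective flow $x^\mu$ is $x^\mu_{ij}=\sum_{\lambda\in\Lambda^\mu_{ij}}x_\lambda$ with $\Lambda^\mu_{ij}=\{\lambda\in\Lambda:(i,j)\in\lambda\text{ and }\mu_{i'j'}=0\ \forall(i',j')\in\lambda\}$; $F(x-x^\mu)$ is the amount of lost flow. Game $\Gamma$. Player 1 chooses $x\in\mathcal{F}$ and player 2 simultaneously chooses $\mu\in\mathcal{A}$. With $p_1,p_2\in\mathbb{R}^+$, the payoffs are $u_1(x,\mu)=p_1F(x^\mu)-C_1(x)$ and $u_2(x,\mu)=p_2F(x-x^\mu)-C_2(\mu)$. Mixed strategies: $\Delta(\mathcal{F})=\{\sigma^1\in[0,1]^{\mathcal{F}}:\sum_x\sigma^1_x=1\}$, $\Delta(\mathcal{A})=\{\sigma^2\in[0,1]^{\mathcal{A}}:\sum_\mu\sigma^2_\mu=1\}$; $\operatorname{supp}$ is the set of actions with positive probability. For $\sigma=(\sigma^1,\sigma^2)$,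 $\mathbb{E}_\sigma[\varphi(x,\mu)]=\sum_x\sigma^1_x\sum_\mu\sigma^2_\mu\varphi(x,\mu)$ and $U_k(\sigma^1,\sigma^2)=\mathbb{E}_\sigma[u_k(x,\mu)]$. $\mathcal{S}_\Gamma$ is the set of (mixed) Nash equilibria: pairs $({\sigma^1}^*,{\sigma^2}^* )$ with $U_1({\sigma^1}^*,{\sigma^2}^* )\ge U_1(\sigma^1,{\sigma^2}^* )$ for all $\sigma^1\in\Delta(\mathcal{F})$ and $U_2({\sigma^1}^*,{\sigma^2}^* )\ge U_2({\sigma^1}^*,\sigma^2)$ for all $\sigma^2\in\Delta(\mathcal{A})$. A pure Nash equilibrium is one in which each player chooses a single action with probability one. Assumption 1. Let $\alpha=\min_{\lambda\in\Lambda_{path}}\sum_{(i,j)\in\lambda}b_{ij}$. There exists $x^*\in\Omega$ such that for all $\lambda\in\Lambda_{path}$, $x^*_\lambda>0$ implies $\sum_{(i,j)\in\lambda}b_{ij}=\alpha$.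
   Formalization: Adds that α > 0 and that some feasible flow has positive value (if either fails, a pure equilibrium exists and the claim is false), and reads "flow can only leave from t" as: no edge starts at t. *)

theory Defs
  imports "HOL-Probability.Probability" "Graph_Theory.Graph_Theory"
begin

record 'v network =
  graph :: "'v pair_pre_digraph"
  source :: 'v
  sink :: 'v
  capacity :: "'v \<times> 'v \<Rightarrow> real"
  cost :: "'v \<times> 'v \<Rightarrow> real"

abbreviation edges :: "'v network \<Rightarrow> ('v \<times> 'v) set" where
  "edges N \<equiv> parcs (graph N)"

abbreviation vertices :: "'v network \<Rightarrow> 'v set" where
  "vertices N \<equiv> pverts (graph N)"

text \<open>
  The last clause of \<open>network\<close> renders "flow can only leave the network from the destination":
  no edge starts at the sink. Without it, a loop through the sink would be counted by
  \<open>flow_value\<close>, which then would not be the amount of flow passing from source to sink.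
\<close>

definition network :: "'v network \<Rightarrow> bool" where
  "network N \<longleftrightarrow>
     pair_fin_digraph (graph N) \<and>
     source N \<in> vertices N \<and> sink N \<in> vertices N \<and> source N \<noteq> sink N \<and>
     (\<forall>e\<in>edges N. 0 \<le> capacity N e \<and> 0 \<le> cost N e) \<and>
     (\<forall>j. (sink N, j) \<notin> edges N)"

text \<open>
  Flows and attacks are functions on the edge set; they are extended by 0 to all pairs of
  vertices, so that distinct HOL functions are distinct actions.
\<close>

type_synonym 'v flow = "'v \<times> 'v \<Rightarrow> real"
type_synonym 'v attack = "'v \<times> 'v \<Rightarrow> nat"

definition feasible_flows :: "'v network \<Rightarrow> 'v flow set" where
  "feasible_flows N =
     {x. (\<forall>i\<in>vertices N - {source N, sink N}.
            (\<Sum>j | (j, i) \<in> edges N. x (j, i)) = (\<Sum>j | (i, j) \<in> edges N. x (i, j))) \<and>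
         (\<forall>e\<in>edges N. 0 \<le> x e \<and> x e \<le> capacity N e) \<and>
         (\<forall>e. e \<notin> edges N \<longrightarrow> x e = 0)}"

definition attacks :: "'v network \<Rightarrow> 'v attack set" where
  "attacks N = {\<mu>. (\<forall>e\<in>edges N. \<mu> e \<in> {0, 1}) \<and> (\<forall>e. e \<notin> edges N \<longrightarrow> \<mu> e = 0)}"

definition flow_value :: "'v network \<Rightarrow> 'v flow \<Rightarrow> real" where
  "flow_value N x = (\<Sum>i | i \<in> vertices N \<and> (i, sink N) \<in> edges N. x (i, sink N))"

definition transport_cost :: "'v network \<Rightarrow> 'v flow \<Rightarrow> real" where
  "transport_cost N x = (\<Sum>e\<in>edges N. cost N e * x e)"

definition attack_cost :: "'v network \<Rightarrow> 'v attack \<Rightarrow> real" where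
  "attack_cost N \<mu> = (\<Sum>e\<in>edges N. capacity N e * real (\<mu> e))"

definition max_flows :: "'v network \<Rightarrow> 'v flow set" where
  "max_flows N =
     {x \<in> feasible_flows N. \<forall>x'\<in>feasible_flows N. flow_value N x' \<le> flow_value N x}"

definition min_cost_max_flows :: "'v network \<Rightarrow> 'v flow set" where
  "min_cost_max_flows N =
     {x \<in> max_flows N. \<forall>x'\<in>max_flows N. transport_cost N x \<le> transport_cost N x'}"

text \<open>
  Paths and loops are simple and are represented by their edge sets; hence a loop is counted
  once, and not once for every choice of its starting vertex.
\<close>

definition st_paths :: "'v network \<Rightarrow> ('v \<times> 'v) set set" where
  "st_paths N =
     {set p | p. pre_digraph.apath (with_proj (graph N)) (source N) p (sink N)}"

definition loops :: "'v network \<Rightarrow> ('v \<times> 'v) set set" where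
  "loops N = {set p | p. pre_digraph.cycle (with_proj (graph N)) p}"

definition routes :: "'v network \<Rightarrow> ('v \<times> 'v) set set" where
  "routes N = loops N \<union> st_paths N"

text \<open>
  The values of a flow on the edges do not determine the quantities sent through the individual
  paths and loops. A decomposition rule \<open>dec\<close> selects these quantities for every feasible flow:
  \<open>dec x l\<close> is the quantity of flow of \<open>x\<close> sent through \<open>l\<close>.
\<close>

type_synonym 'v decomposition = "'v flow \<Rightarrow> ('v \<times> 'v) set \<Rightarrow> real"

definition decomposition_rule :: "'v network \<Rightarrow> 'v decomposition \<Rightarrow> bool" where
  "decomposition_rule N dec \<longleftrightarrow>
     (\<forall>x\<in>feasible_flows N.
        (\<forall>l\<in>routes N. 0 \<le> dec x l) \<and>
        (\<forall>e\<in>edges N. x e = (\<Sum>l | l \<in> routes N \<and> e \<in> l. dec x l)))"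

definition effective_flow ::
    "'v network \<Rightarrow> 'v decomposition \<Rightarrow> 'v flow \<Rightarrow> 'v attack \<Rightarrow> 'v flow" where
  "effective_flow N dec x \<mu> =
     (\<lambda>e. \<Sum>l | l \<in> routes N \<and> e \<in> l \<and> (\<forall>e'\<in>l. \<mu> e' = 0). dec x l)"

definition min_path_cost :: "'v network \<Rightarrow> real" where
  "min_path_cost N = Min ((\<lambda>l. \<Sum>e\<in>l. cost N e) ` st_paths N)"

definition cheapest_max_flow :: "'v network \<Rightarrow> 'v decomposition \<Rightarrow> 'v flow \<Rightarrow> bool" where
  "cheapest_max_flow N dec x \<longleftrightarrow>
     x \<in> min_cost_max_flows N \<and>
     (\<forall>l\<in>st_paths N. dec x l > 0 \<longrightarrow> (\<Sum>e\<in>l. cost N e) = min_path_cost N)"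

definition st_cut :: "'v network \<Rightarrow> 'v set \<Rightarrow> 'v set \<Rightarrow> bool" where
  "st_cut N S T \<longleftrightarrow>
     S \<union> T = vertices N \<and> S \<inter> T = {} \<and> source N \<in> S \<and> sink N \<in> T"

definition cut_set :: "'v network \<Rightarrow> 'v set \<Rightarrow> ('v \<times> 'v) set" where
  "cut_set N S = {(i, j) \<in> edges N. i \<in> S \<and> j \<notin> S}"

definition cut_capacity :: "'v network \<Rightarrow> 'v set \<Rightarrow> real" where
  "cut_capacity N S = (\<Sum>e\<in>cut_set N S. capacity N e)"

definition min_cut :: "'v network \<Rightarrow> 'v set \<Rightarrow> 'v set \<Rightarrow> bool" where
  "min_cut N S T \<longleftrightarrow>
     st_cut N S T \<and> (\<forall>S' T'. st_cut N S' T' \<longrightarrow> cut_capacity N S \<le> cut_capacity N S')"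

definition payoff1 ::
    "'v network \<Rightarrow> 'v decomposition \<Rightarrow> real \<Rightarrow> 'v flow \<Rightarrow> 'v attack \<Rightarrow> real" where
  "payoff1 N dec p1 x \<mu> = p1 * flow_value N (effective_flow N dec x \<mu>) - transport_cost N x"

definition payoff2 ::
    "'v network \<Rightarrow> 'v decomposition \<Rightarrow> real \<Rightarrow> 'v flow \<Rightarrow> 'v attack \<Rightarrow> real" where
  "payoff2 N dec p2 x \<mu> =
     p2 * flow_value N (\<lambda>e. x e - effective_flow N dec x \<mu> e) - attack_cost N \<mu>"

text \<open>
  A function from actions to \<open>[0, 1]\<close> whose values sum up to 1 is the mass function of a unique
  \<open>pmf\<close>, also when there are uncountably many actions. The payoffs are bounded on the action
  sets, so the integrals below are the (absolutely convergent) sums defining the expectation.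
\<close>

definition mixed_flows :: "'v network \<Rightarrow> 'v flow pmf set" where
  "mixed_flows N = {\<sigma>. set_pmf \<sigma> \<subseteq> feasible_flows N}"

definition mixed_attacks :: "'v network \<Rightarrow> 'v attack pmf set" where
  "mixed_attacks N = {\<sigma>. set_pmf \<sigma> \<subseteq> attacks N}"

definition expected ::
    "'v flow pmf \<Rightarrow> 'v attack pmf \<Rightarrow> ('v flow \<Rightarrow> 'v attack \<Rightarrow> real) \<Rightarrow> real" where
  "expected \<sigma>1 \<sigma>2 \<phi> =
     measure_pmf.expectation \<sigma>1 (\<lambda>x. measure_pmf.expectation \<sigma>2 (\<lambda>\<mu>. \<phi> x \<mu>))"

definition nash_equilibria ::
    "'v network \<Rightarrow> 'v decomposition \<Rightarrow> real \<Rightarrow> real \<Rightarrow> ('v flow pmf \<times> 'v attack pmf) set" where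
  "nash_equilibria N dec p1 p2 =
     {(\<sigma>1, \<sigma>2). \<sigma>1 \<in> mixed_flows N \<and> \<sigma>2 \<in> mixed_attacks N \<and>
        (\<forall>\<tau>1\<in>mixed_flows N.
           expected \<tau>1 \<sigma>2 (payoff1 N dec p1) \<le> expected \<sigma>1 \<sigma>2 (payoff1 N dec p1)) \<and>
        (\<forall>\<tau>2\<in>mixed_attacks N.
           expected \<sigma>1 \<tau>2 (payoff2 N dec p2) \<le> expected \<sigma>1 \<sigma>2 (payoff2 N dec p2))}"

definition zero_flow :: "'v flow" where
  "zero_flow = (\<lambda>_. 0)"

definition zero_attack :: "'v attack" where
  "zero_attack = (\<lambda>_. 0)"

definition cut_attack :: "'v network \<Rightarrow> 'v set \<Rightarrow> 'v attack" where
  "cut_attack N S = indicator (cut_set N S)"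

end

theory Submission
  imports Defs
begin

text \<open>
  Let \<open>\<alpha>\<close> be the cost of a cheapest path. Against the mixture of \<open>zero_attack\<close> and the attack on a
  minimum cut, which disrupts every path, a flow \<open>x\<close> earns \<open>\<alpha> F(x) - C\<^sub>1(x) \<le> 0\<close>, with equality for
  the flow of Assumption 1. Against the mixture of \<open>zero_flow\<close> and that flow, an attack earns the lost
  flow minus its cost; this is at most 0, since the lost flow is bounded by the attacked capacity,
  and it is 0 for a minimum cut by the max-flow min-cut theorem.

  In a pure equilibrium no flow is lost, since player 1 would save the cost of the disrupted paths.
  So the attack costs nothing and is harmless, hence the flow is maximum because \<open>p\<^sub>1 > \<alpha>\<close>. Then
  attacking a minimum cut pays because \<open>p\<^sub>2 > 1\<close>.
\<close>

text \<open>Net inflow at \<open>v\<close>, written as one sum over all edges so that it is linear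
  in \<open>x\<close> and a self-loop contributes 0. It makes sense for arbitrary \<open>x\<close>,
  in particular for indicators of routes and directions of change.\<close>

definition excess :: "'v network \<Rightarrow> 'v flow \<Rightarrow> 'v \<Rightarrow> real" where
  "excess N x v = (\<Sum>e\<in>edges N. (of_bool (snd e = v) - of_bool (fst e = v)) * x e)"

text \<open>Superposition of routes with weights \<open>w\<close>. With \<open>w = dec x\<close>,
  all routes give back \<open>x\<close>, the undisrupted ones give the effective flow, and the paths
  alone give \<open>x\<close> without its loops.\<close>

definition route_flow :: "('v \<times> 'v) set set \<Rightarrow> (('v \<times> 'v) set \<Rightarrow> real) \<Rightarrow> 'v flow" where
  "route_flow A w = (\<lambda>e. \<Sum>l | l \<in> A \<and> e \<in> l. w l)"

lemma excess_add: "excess N (\<lambda>e. x e + y e) v = excess N x v + excess N y v"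
  by (simp add: excess_def ring_distribs sum.distrib)

lemma excess_diff: "excess N (\<lambda>e. x e - y e) v = excess N x v - excess N y v"
  by (simp add: excess_def ring_distribs sum_subtractf)

lemma excess_scale: "excess N (\<lambda>e. c * x e) v = c * excess N x v"
  by (simp add: excess_def sum_distrib_left mult_ac)

text \<open>Telescoping: every arc starts where its predecessor ends, so only the two ends of the
  walk survive.\<close>

lemma cas_sum_list:
  assumes "pre_digraph.cas (with_proj G) u p w"
  shows "(\<Sum>e\<leftarrow>p. of_bool (snd e = v) - of_bool (fst e = v)) = (of_bool (w = v) - of_bool (u = v) :: real)"
  using assms
proof (induction p arbitrary: u)
  case Nil
  then show ?case by (simp add: pre_digraph.cas.simps)
next
  case (Cons e p)
  then have "pre_digraph.cas (with_proj G) (snd e) p w" "fst e = u"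
    by (auto simp: pre_digraph.cas.simps)
  with Cons.IH show ?case by simp
qed

definition two_point_pmf :: "real \<Rightarrow> 'a \<Rightarrow> 'a \<Rightarrow> 'a pmf" where
  "two_point_pmf q a b = map_pmf (\<lambda>c. if c then a else b) (bernoulli_pmf q)"

lemma set_two_point_pmf: "0 < q \<Longrightarrow> q < 1 \<Longrightarrow> set_pmf (two_point_pmf q a b) = {a, b}"
  by (auto simp: two_point_pmf_def set_pmf_bernoulli)

lemma expectation_two_point_pmf:
  fixes f :: "'a \<Rightarrow> real"
  assumes "0 \<le> q" "q \<le> 1"
  shows "measure_pmf.expectation (two_point_pmf q a b) f = q * f a + (1 - q) * f b"
  using assms by (simp add: two_point_pmf_def mult.commute)

lemma pmf_two_point_pmf:
  assumes "a \<noteq> b" "0 \<le> q" "q \<le> 1"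
  shows "pmf (two_point_pmf q a b) a = q" "pmf (two_point_pmf q a b) b = 1 - q"
proof -
  have "(\<lambda>c. if c then a else b) -` {a} = {True}" "(\<lambda>c. if c then a else b) -` {b} = {False}"
    using assms(1) by (auto split: if_splits)
  then show "pmf (two_point_pmf q a b) a = q" "pmf (two_point_pmf q a b) b = 1 - q"
    using assms(2,3) by (simp_all add: two_point_pmf_def pmf_map measure_pmf_single)
qed

section \<open>Conservation and cuts\<close>

locale flow_network =
  fixes N :: "'v network"
  assumes network: "network N"
begin

sublocale pair_fin_digraph "graph N"
  using network by (simp add: network_def)

lemma source_sink [simp]:
  "source N \<in> vertices N" "sink N \<in> vertices N" "source N \<noteq> sink N" "sink N \<noteq> source N"
  using network by (auto simp: network_def)

lemma no_edge_from_sink: "e \<in> edges N \<Longrightarrow> fst e \<noteq> sink N"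
  using network by (cases e) (auto simp: network_def)

lemma capacity_nonneg: "e \<in> edges N \<Longrightarrow> 0 \<le> capacity N e"
  and cost_nonneg: "e \<in> edges N \<Longrightarrow> 0 \<le> cost N e"
  using network by (auto simp: network_def)

lemma edge_ends: "e \<in> edges N \<Longrightarrow> fst e \<in> vertices N \<and> snd e \<in> vertices N"
  using arc_fst_in_verts arc_snd_in_verts by blast

lemma finite_edges [simp]: "finite (edges N)"
  by (rule pair_finite_arcs)

lemma finite_vertices [simp]: "finite (vertices N)"
  by (rule pair_finite_verts)

lemma excess_inflow_outflow:
  "excess N x i = (\<Sum>j | (j, i) \<in> edges N. x (j, i)) - (\<Sum>j | (i, j) \<in> edges N. x (i, j))"
proof -
  have "(\<Sum>e\<in>edges N. of_bool (snd e = i) * x e) = (\<Sum>e\<in>{e\<in>edges N. snd e = i}. x e)"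
    by (intro sum.mono_neutral_cong_right) auto
  also have "\<dots> = (\<Sum>j | (j, i) \<in> edges N. x (j, i))"
    by (rule sum.reindex_bij_witness[where i = "\<lambda>j. (j, i)" and j = fst]) auto
  finally have i: "(\<Sum>e\<in>edges N. of_bool (snd e = i) * x e) = (\<Sum>j | (j, i) \<in> edges N. x (j, i))" .
  have "(\<Sum>e\<in>edges N. of_bool (fst e = i) * x e) = (\<Sum>e\<in>{e\<in>edges N. fst e = i}. x e)"
    by (intro sum.mono_neutral_cong_right) auto
  also have "\<dots> = (\<Sum>j | (i, j) \<in> edges N. x (i, j))"
    by (rule sum.reindex_bij_witness[where i = "\<lambda>j. (i, j)" and j = snd]) auto
  finally show ?thesis
    using i by (simp add: excess_def left_diff_distrib sum_subtractf)
qed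

lemma feasible_flows_iff:
  "x \<in> feasible_flows N \<longleftrightarrow>
     (\<forall>i\<in>vertices N - {source N, sink N}. excess N x i = 0) \<and>
     (\<forall>e\<in>edges N. 0 \<le> x e \<and> x e \<le> capacity N e) \<and> (\<forall>e. e \<notin> edges N \<longrightarrow> x e = 0)"
  by (auto simp: feasible_flows_def excess_inflow_outflow)

text \<open>The outflow of the sink is an empty sum. This makes the flow value linear and puts it in
  the same form as conservation.\<close>

lemma flow_value_excess: "flow_value N x = excess N x (sink N)"
proof -
  have "{i. i \<in> vertices N \<and> (i, sink N) \<in> edges N} = {i. (i, sink N) \<in> edges N}"
    using edge_ends by fastforce
  moreover have "{j. (sink N, j) \<in> edges N} = {}"
    using no_edge_from_sink by fastforce
  ultimately show ?thesis
    by (simp add: flow_value_def excess_inflow_outflow)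
qed

lemma zero_flow_feasible: "zero_flow \<in> feasible_flows N"
  by (simp add: zero_flow_def feasible_flows_iff excess_def capacity_nonneg)

lemma cut_set_subset: "cut_set N S \<subseteq> edges N"
  by (auto simp: cut_set_def)

lemma finite_cut_set [simp]: "finite (cut_set N S)"
  using cut_set_subset finite_edges by (rule finite_subset)

text \<open>After exchanging the sums, an edge counts 1 if it enters \<open>T\<close>, -1 if it
  leaves \<open>T\<close>, and 0 otherwise. As \<open>x\<close> need not be a flow, this applies to
  indicators of paths too.\<close>

lemma sum_excess_cut:
  assumes "st_cut N S T"
  shows "(\<Sum>v\<in>T. excess N x v) = (\<Sum>e\<in>cut_set N S. x e) - (\<Sum>e\<in>cut_set N T. x e)"
proof -
  have fin: "finite T"
    using assms by (metis finite_Un finite_vertices st_cut_def)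
  have in_S: "v \<in> S \<longleftrightarrow> v \<notin> T" if "v \<in> vertices N" for v
    using assms that by (auto simp: st_cut_def)
  have "(\<Sum>v\<in>T. excess N x v) =
      (\<Sum>e\<in>edges N. \<Sum>v\<in>T. (of_bool (snd e = v) - of_bool (fst e = v)) * x e)"
    unfolding excess_def by (rule sum.swap)
  also have "\<dots> = (\<Sum>e\<in>edges N. of_bool (e \<in> cut_set N S) * x e - of_bool (e \<in> cut_set N T) * x e)"
  proof (rule sum.cong)
    fix e assume e: "e \<in> edges N"
    have "(\<Sum>v\<in>T. (of_bool (snd e = v) - of_bool (fst e = v)) * x e) =
        (of_bool (snd e \<in> T) - of_bool (fst e \<in> T)) * x e"
      using fin by (simp add: sum_distrib_right[symmetric] sum_subtractf of_bool_def)
    also have "\<dots> = of_bool (e \<in> cut_set N S) * x e - of_bool (e \<in> cut_set N T) * x e"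
      using e in_S[of "fst e"] in_S[of "snd e"] edge_ends[OF e]
      by (cases "fst e \<in> T"; cases "snd e \<in> T") (auto simp: cut_set_def split_beta)
    finally show "(\<Sum>v\<in>T. (of_bool (snd e = v) - of_bool (fst e = v)) * x e) =
        of_bool (e \<in> cut_set N S) * x e - of_bool (e \<in> cut_set N T) * x e" .
  qed simp
  also have "\<dots> = (\<Sum>e\<in>cut_set N S. x e) - (\<Sum>e\<in>cut_set N T. x e)"
  proof -
    have "(\<Sum>e\<in>edges N. of_bool (e \<in> C) * x e) = (\<Sum>e\<in>C. x e)" if "C \<subseteq> edges N" for C
      using that by (intro sum.mono_neutral_cong_right) auto
    then show ?thesis
      by (simp add: sum_subtractf cut_set_subset)
  qed
  finally show ?thesis .
qed

text \<open>By conservation, the sink is the only vertex of \<open>T\<close> with nonzero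
  excess.\<close>

lemma flow_value_cut:
  assumes "x \<in> feasible_flows N" "st_cut N S T"
  shows "flow_value N x = (\<Sum>e\<in>cut_set N S. x e) - (\<Sum>e\<in>cut_set N T. x e)"
proof -
  have T: "finite T" "sink N \<in> T" "T \<subseteq> vertices N" "source N \<notin> T"
    using assms(2) by (auto simp: st_cut_def intro: finite_subset[OF _ finite_vertices])
  have "(\<Sum>v\<in>T. excess N x v) = (\<Sum>v\<in>{sink N}. excess N x v)"
    using T assms(1) by (intro sum.mono_neutral_right) (auto simp: feasible_flows_iff)
  then show ?thesis
    using sum_excess_cut[OF assms(2)] by (simp add: flow_value_excess)
qed

lemma flow_value_le_cut_capacity:
  assumes "x \<in> feasible_flows N" "st_cut N S T"
  shows "flow_value N x \<le> cut_capacity N S"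
proof -
  have "0 \<le> (\<Sum>e\<in>cut_set N T. x e)" "(\<Sum>e\<in>cut_set N S. x e) \<le> cut_capacity N S"
    using assms(1) cut_set_subset unfolding cut_capacity_def feasible_flows_iff
    by (auto intro!: sum_nonneg sum_mono)
  then show ?thesis
    by (simp add: flow_value_cut[OF assms])
qed

section \<open>Maximum flows and minimum cuts\<close>

text \<open>The cone of directions along which a small step from \<open>x\<close> respects the
  capacities; conservation is tracked separately through \<open>excess\<close>. Admitting all steps
  up to some \<epsilon> lets two directions share a common step length.\<close>

definition bounded_directions :: "'v flow \<Rightarrow> 'v flow set" where
  "bounded_directions x = {d. (\<forall>e. e \<notin> edges N \<longrightarrow> d e = 0) \<and>
     (\<exists>\<epsilon>>0. \<forall>\<delta>. 0 \<le> \<delta> \<and> \<delta> \<le> \<epsilon> \<longrightarrow>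
        (\<forall>e\<in>edges N. 0 \<le> x e + \<delta> * d e \<and> x e + \<delta> * d e \<le> capacity N e))}"

text \<open>
  Closure under addition is convexity of the capacity constraints; it allows augmenting along
  residual walks that need not be simple.
\<close>

lemma bounded_directions_add:
  assumes "d \<in> bounded_directions x" "d' \<in> bounded_directions x"
  shows "(\<lambda>e. d e + d' e) \<in> bounded_directions x"
proof -
  obtain \<epsilon> where \<epsilon>: "\<epsilon> > 0" "\<And>\<delta> e. 0 \<le> \<delta> \<Longrightarrow> \<delta> \<le> \<epsilon> \<Longrightarrow> e \<in> edges N \<Longrightarrow>
      0 \<le> x e + \<delta> * d e \<and> x e + \<delta> * d e \<le> capacity N e"
    using assms(1) by (auto simp: bounded_directions_def)
  obtain \<epsilon>' where \<epsilon>': "\<epsilon>' > 0" "\<And>\<delta> e. 0 \<le> \<delta> \<Longrightarrow> \<delta> \<le> \<epsilon>' \<Longrightarrow> e \<in> edges N \<Longrightarrow>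
      0 \<le> x e + \<delta> * d' e \<and> x e + \<delta> * d' e \<le> capacity N e"
    using assms(2) by (auto simp: bounded_directions_def)
  \<comment> \<open>The new point is the midpoint of \<open>x + 2 \<delta> d\<close> and
    \<open>x + 2 \<delta> d'\<close>, which is why the bound on \<delta> is halved.\<close>
  have "0 \<le> x e + \<delta> * (d e + d' e) \<and> x e + \<delta> * (d e + d' e) \<le> capacity N e"
    if "0 \<le> \<delta>" "\<delta> \<le> min \<epsilon> \<epsilon>' / 2" "e \<in> edges N" for \<delta> e
    using \<epsilon>(2)[of "2 * \<delta>" e] \<epsilon>'(2)[of "2 * \<delta>" e] that by (simp add: ring_distribs)
  moreover have "min \<epsilon> \<epsilon>' / 2 > 0"
    using \<epsilon>(1) \<epsilon>'(1) by simp
  moreover have "\<forall>e. e \<notin> edges N \<longrightarrow> d e + d' e = 0"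
    using assms by (simp add: bounded_directions_def)
  ultimately show ?thesis
    unfolding bounded_directions_def by blast
qed

definition residual :: "'v flow \<Rightarrow> ('v \<times> 'v) set" where
  "residual x = {(u, v). ((u, v) \<in> edges N \<and> x (u, v) < capacity N (u, v)) \<or>
                         ((v, u) \<in> edges N \<and> 0 < x (v, u))}"

lemma residual_direction:
  assumes "x \<in> feasible_flows N" "(u, v) \<in> residual x"
  shows "\<exists>d\<in>bounded_directions x. \<forall>i. excess N d i = of_bool (v = i) - of_bool (u = i)"
proof -
  have x: "0 \<le> x e \<and> x e \<le> capacity N e" if "e \<in> edges N" for e
    using assms(1) that by (auto simp: feasible_flows_iff)
  have single: "excess N (\<lambda>e. c * of_bool (e = a)) i = c * (of_bool (snd a = i) - of_bool (fst a = i))"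
    if "a \<in> edges N" for a c i
  proof -
    have "excess N (\<lambda>e. c * of_bool (e = a)) i =
        (\<Sum>e\<in>edges N. if e = a then c * (of_bool (snd a = i) - of_bool (fst a = i)) else 0)"
      unfolding excess_def by (intro sum.cong) auto
    with that show ?thesis by simp
  qed
  from assms(2) consider "(u, v) \<in> edges N" "x (u, v) < capacity N (u, v)"
    | "(v, u) \<in> edges N" "0 < x (v, u)"
    by (auto simp: residual_def)
  then show ?thesis
  proof cases
    case 1
    have "(\<lambda>e. 1 * of_bool (e = (u, v))) \<in> bounded_directions x"
      unfolding bounded_directions_def mem_Collect_eq
    proof (intro conjI exI[of _ "capacity N (u, v) - x (u, v)"])
    qed (use 1 x in \<open>auto simp: of_bool_def intro: add_increasing2\<close>)
    with single[OF 1(1), of 1] show ?thesis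
      by (metis (no_types, lifting) fst_conv mult_1 snd_conv)
  next
    case 2
    have "(\<lambda>e. -1 * of_bool (e = (v, u))) \<in> bounded_directions x"
      unfolding bounded_directions_def mem_Collect_eq
    proof (intro conjI exI[of _ "x (v, u)"])
    qed (use 2 x in \<open>(auto simp: of_bool_def, smt (verit))\<close>)
    with single[OF 2(1), of "-1"] show ?thesis
      by (metis (no_types, lifting) fst_conv minus_diff_eq mult_minus1 snd_conv)
  qed
qed

text \<open>The directions of the arcs of a residual walk are added up; the excesses at intermediate
  vertices cancel.\<close>

lemma reachable_direction:
  assumes "x \<in> feasible_flows N" "(source N, v) \<in> (residual x)\<^sup>*"
  shows "\<exists>d\<in>bounded_directions x. \<forall>i. excess N d i = of_bool (v = i) - of_bool (source N = i)"
  using assms(2)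
proof (induction rule: rtrancl_induct)
  case base
  have "(\<lambda>_. 0) \<in> bounded_directions x"
    using assms(1) by (auto simp: bounded_directions_def feasible_flows_iff intro: exI[of _ 1])
  then show ?case
    by (auto simp: excess_def intro!: bexI[of _ "\<lambda>_. 0"])
next
  case (step u v)
  obtain d where d: "d \<in> bounded_directions x"
      "\<And>i. excess N d i = of_bool (u = i) - of_bool (source N = i)"
    using step.IH by blast
  obtain d' where d': "d' \<in> bounded_directions x"
      "\<And>i. excess N d' i = of_bool (v = i) - of_bool (u = i)"
    using residual_direction[OF assms(1) step.hyps(2)] by blast
  show ?case
    using bounded_directions_add[OF d(1) d'(1)] d(2) d'(2)
    by (intro bexI[of _ "\<lambda>e. d e + d' e"]) (auto simp: excess_add)
qed

text \<open>Otherwise a step of length \<epsilon> along the resulting direction would preserve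
  feasibility and raise the value by \<epsilon>.\<close>

lemma sink_not_reachable:
  assumes "x \<in> max_flows N"
  shows "(source N, sink N) \<notin> (residual x)\<^sup>*"
proof
  assume "(source N, sink N) \<in> (residual x)\<^sup>*"
  have x: "x \<in> feasible_flows N"
    using assms by (simp add: max_flows_def)
  obtain d where d: "d \<in> bounded_directions x"
      "\<And>i. excess N d i = of_bool (sink N = i) - of_bool (source N = i)"
    using reachable_direction[OF x \<open>(source N, sink N) \<in> (residual x)\<^sup>*\<close>] by blast
  obtain \<epsilon> where \<epsilon>: "\<epsilon> > 0"
      "\<forall>e\<in>edges N. 0 \<le> x e + \<epsilon> * d e \<and> x e + \<epsilon> * d e \<le> capacity N e"
    using d(1) by (force simp: bounded_directions_def)
  let ?y = "\<lambda>e. x e + \<epsilon> * d e"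
  have ex: "excess N ?y i = excess N x i + \<epsilon> * (of_bool (sink N = i) - of_bool (source N = i))" for i
    by (simp add: excess_add excess_scale d(2))
  have "?y \<in> feasible_flows N"
    using x d(1) \<epsilon>(2) by (auto simp: feasible_flows_iff ex bounded_directions_def)
  then have "flow_value N ?y \<le> flow_value N x"
    using assms by (simp add: max_flows_def)
  with \<epsilon>(1) show False
    by (simp add: flow_value_excess ex)
qed

text \<open>Take the vertices reachable from the source in the residual graph. An edge leaving this
  set is full and an edge entering it is empty, since otherwise its outer end would be reachable as
  well.\<close>

lemma max_flow_saturates_cut:
  assumes "x \<in> max_flows N"
  shows "\<exists>S T. st_cut N S T \<and> cut_capacity N S = flow_value N x"
proof -
  define S where "S = {v \<in> vertices N. (source N, v) \<in> (residual x)\<^sup>*}"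
  have x: "x \<in> feasible_flows N"
    using assms by (simp add: max_flows_def)
  have cut: "st_cut N S (vertices N - S)"
    using sink_not_reachable[OF assms] by (auto simp: st_cut_def S_def)
  have closed: "v \<in> S" if "u \<in> S" "(u, v) \<in> residual x" "v \<in> vertices N" for u v
    using that by (auto simp: S_def intro: rtrancl_into_rtrancl)
  have "x e = capacity N e" if "e \<in> cut_set N S" for e
  proof -
    obtain i j where ij: "e = (i, j)"
      by (cases e)
    with that have e: "e = (i, j)" "(i, j) \<in> edges N" "i \<in> S" "j \<notin> S"
      by (auto simp: cut_set_def)
    then have "(i, j) \<notin> residual x"
      using closed edge_ends by fastforce
    with e x show ?thesis
      by (force simp: residual_def feasible_flows_iff)
  qed
  moreover have "x e = 0" if "e \<in> cut_set N (vertices N - S)" for e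
  proof -
    obtain i j where ij: "e = (i, j)"
      by (cases e)
    with that edge_ends[of e] have e: "e = (i, j)" "(i, j) \<in> edges N" "i \<in> vertices N - S" "j \<in> S"
      by (auto simp: cut_set_def)
    then have "(j, i) \<notin> residual x"
      using closed by blast
    with e x show ?thesis
      by (force simp: residual_def feasible_flows_iff)
  qed
  ultimately have "flow_value N x = cut_capacity N S"
    by (simp add: flow_value_cut[OF x cut] cut_capacity_def)
  with cut show ?thesis by metis
qed

lemma min_cut_exists:
  assumes "x \<in> max_flows N"
  shows "\<exists>S T. min_cut N S T"
proof -
  obtain S T where "st_cut N S T" "cut_capacity N S = flow_value N x"
    using max_flow_saturates_cut[OF assms] by blast
  then have "min_cut N S T"
    using flow_value_le_cut_capacity[of x] assms by (auto simp: min_cut_def max_flows_def)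
  then show ?thesis by blast
qed

text \<open>The capacity is squeezed between the flow value, a lower bound for every cut, and the
  capacity of the cut that \<open>x\<close> saturates.\<close>

lemma min_cut_capacity:
  assumes "x \<in> max_flows N" "min_cut N S T"
  shows "cut_capacity N S = flow_value N x"
proof -
  obtain S' T' where "st_cut N S' T'" "cut_capacity N S' = flow_value N x"
    using max_flow_saturates_cut[OF assms(1)] by blast
  with assms flow_value_le_cut_capacity[of x S T] show ?thesis
    by (force simp: min_cut_def max_flows_def)
qed

section \<open>Routes\<close>

text \<open>Distinctness turns the sum over the edge set into the telescoping sum along the
  walk.\<close>

lemma excess_indicator_walk:
  assumes "awalk u p w" "distinct p"
  shows "excess N (indicator (set p)) v = of_bool (w = v) - of_bool (u = v)"
proof -
  have "excess N (indicator (set p)) v = (\<Sum>e\<in>set p. of_bool (snd e = v) - of_bool (fst e = v))"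
    using assms(1) unfolding excess_def
    by (intro sum.mono_neutral_cong_right) (auto simp: awalk_def indicator_def)
  also have "\<dots> = (\<Sum>e\<leftarrow>p. of_bool (snd e = v) - of_bool (fst e = v))"
    using assms(2) by (simp add: sum_list_distinct_conv_sum_set)
  also have "\<dots> = of_bool (w = v) - of_bool (u = v)"
    using assms(1) by (intro cas_sum_list[where G = "graph N"]) (simp add: awalk_def)
  finally show ?thesis .
qed

lemma route_cases:
  assumes "l \<in> routes N"
  obtains (path) "l \<in> st_paths N" "\<And>v. excess N (indicator l) v = of_bool (sink N = v) - of_bool (source N = v)"
    | (loop) "l \<in> loops N" "\<And>v. excess N (indicator l) v = 0"
  using assms unfolding routes_def
proof (elim UnE)
  assume l: "l \<in> loops N"
  then obtain p where "cycle p" "l = set p"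
    by (auto simp: loops_def)
  then obtain u where "awalk u p u" "distinct p"
    unfolding cycle_conv by auto
  with \<open>l = set p\<close> have "excess N (indicator l) v = 0" for v
    by (simp add: excess_indicator_walk)
  with l show thesis by (rule loop)
next
  assume l: "l \<in> st_paths N"
  then obtain p where "apath (source N) p (sink N)" "l = set p"
    by (auto simp: st_paths_def)
  then have "awalk (source N) p (sink N)" "distinct p"
    using distinct_verts_imp_distinct by (auto simp: apath_def)
  with \<open>l = set p\<close> have "excess N (indicator l) v = of_bool (sink N = v) - of_bool (source N = v)" for v
    by (simp add: excess_indicator_walk)
  with l show thesis by (rule path)
qed

lemma route_subset:
  assumes "l \<in> routes N"
  shows "l \<subseteq> edges N"
  using assms by (auto simp: routes_def loops_def st_paths_def cycle_def apath_def awalk_def)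

lemma finite_routes: "finite (routes N)"
  by (rule finite_subset[of _ "Pow (edges N)"]) (use route_subset in auto)

lemma st_path_route: "l \<in> st_paths N \<Longrightarrow> l \<in> routes N"
  by (simp add: routes_def)

lemma excess_st_path:
  assumes "l \<in> routes N"
  shows "excess N (indicator l) (sink N) = of_bool (l \<in> st_paths N)"
  using assms
proof (cases rule: route_cases)
  case loop
  \<comment> \<open>Routes are bare edge sets, so paths and loops have to be told apart: the excess
    at the sink is 1 for a path and 0 for a loop.\<close>
  have "l \<notin> st_paths N"
  proof
    assume "l \<in> st_paths N"
    then obtain p where "apath (source N) p (sink N)" "l = set p"
      by (auto simp: st_paths_def)
    then have "awalk (source N) p (sink N)" "distinct p"
      using distinct_verts_imp_distinct by (auto simp: apath_def)
    from excess_indicator_walk[OF this, of "sink N"] loop \<open>l = set p\<close> show False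
      by simp
  qed
  with loop show ?thesis by simp
qed simp

lemma excess_route_inner:
  assumes "l \<in> routes N" "v \<noteq> source N" "v \<noteq> sink N"
  shows "excess N (indicator l) v = 0"
  using assms(1) by (cases rule: route_cases) (use assms in auto)

text \<open>The indicator of a path has total excess 1 on \<open>T\<close>, so it cannot vanish on
  all edges from \<open>S\<close> to \<open>T\<close>.\<close>

lemma st_path_crosses_cut:
  assumes "l \<in> st_paths N" "st_cut N S T"
  shows "l \<inter> cut_set N S \<noteq> {}"
proof
  assume none: "l \<inter> cut_set N S = {}"
  have T: "finite T" "sink N \<in> T" "source N \<notin> T"
    using assms(2) by (auto simp: st_cut_def intro: finite_subset[OF _ finite_vertices])
  have "(\<Sum>v\<in>T. excess N (indicator l) v) = (\<Sum>v\<in>{sink N}. excess N (indicator l) v)"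
    using T assms(1) excess_route_inner[OF st_path_route[OF assms(1)]]
    by (intro sum.mono_neutral_right) (auto, metis)
  then have "(\<Sum>v\<in>T. excess N (indicator l) v) = 1"
    using excess_st_path[OF st_path_route[OF assms(1)]] assms(1) by simp
  moreover have "(\<Sum>e\<in>cut_set N S. indicator l e) = (0::real)"
    using none by (intro sum.neutral) (auto simp: indicator_def)
  moreover have "(\<Sum>e\<in>cut_set N T. indicator l e) \<ge> (0::real)"
    by (intro sum_nonneg) auto
  ultimately show False
    using sum_excess_cut[OF assms(2), of "indicator l"] by linarith
qed

lemma route_flow_indicator:
  assumes "A \<subseteq> routes N"
  shows "route_flow A w e = (\<Sum>l\<in>A. w l * indicator l e)"
  unfolding route_flow_def
  by (rule sum.mono_neutral_cong_left)
    (use assms finite_subset[OF _ finite_routes] in \<open>auto simp: indicator_def\<close>)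

lemma route_flow_zero: "(\<And>l. l \<in> A \<Longrightarrow> e \<notin> l) \<Longrightarrow> route_flow A w e = 0"
  unfolding route_flow_def by (intro sum.neutral) auto

text \<open>Exchanging sums over edges and routes reduces every linear functional of a superposition
  to its values on single routes; excess, value and both cost estimates are obtained this
  way.\<close>

lemma sum_route_flow:
  assumes "A \<subseteq> routes N"
  shows "(\<Sum>e\<in>B. h e * route_flow A w e) = (\<Sum>l\<in>A. w l * (\<Sum>e\<in>B. h e * indicator l e))"
proof -
  have "(\<Sum>e\<in>B. h e * route_flow A w e) = (\<Sum>e\<in>B. \<Sum>l\<in>A. w l * (h e * indicator l e))"
    by (simp add: route_flow_indicator[OF assms] sum_distrib_left mult_ac)
  also have "\<dots> = (\<Sum>l\<in>A. w l * (\<Sum>e\<in>B. h e * indicator l e))"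
    by (subst sum.swap) (simp add: sum_distrib_left)
  finally show ?thesis .
qed

lemma excess_route_flow:
  assumes "A \<subseteq> routes N"
  shows "excess N (route_flow A w) v = (\<Sum>l\<in>A. w l * excess N (indicator l) v)"
  unfolding excess_def by (rule sum_route_flow[OF assms])

lemma flow_value_route_flow:
  assumes "A \<subseteq> routes N"
  shows "flow_value N (route_flow A w) = (\<Sum>l\<in>A \<inter> st_paths N. w l)"
proof -
  have "flow_value N (route_flow A w) = (\<Sum>l\<in>A. w l * of_bool (l \<in> st_paths N))"
    unfolding flow_value_excess excess_route_flow[OF assms]
    using assms by (intro sum.cong) (auto simp: excess_st_path)
  also have "\<dots> = (\<Sum>l\<in>A \<inter> st_paths N. w l)"
    by (rule sum.mono_neutral_cong_right) (use assms finite_subset[OF _ finite_routes] in auto)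
  finally show ?thesis .
qed

lemma transport_cost_route_flow:
  assumes "A \<subseteq> routes N"
  shows "transport_cost N (route_flow A w) = (\<Sum>l\<in>A. w l * (\<Sum>e\<in>l. cost N e))"
proof -
  have "(\<Sum>e\<in>edges N. cost N e * indicator l e) = (\<Sum>e\<in>l. cost N e)" if "l \<in> A" for l
    using route_subset[of l] assms that
    by (intro sum.mono_neutral_cong_right) (auto simp: indicator_def)
  then show ?thesis
    unfolding transport_cost_def sum_route_flow[OF assms] by simp
qed

lemma route_cost_nonneg: "l \<in> routes N \<Longrightarrow> 0 \<le> (\<Sum>e\<in>l. cost N e)"
  using route_subset cost_nonneg by (intro sum_nonneg) blast

lemma min_path_cost_le:
  assumes "l \<in> st_paths N"
  shows "min_path_cost N \<le> (\<Sum>e\<in>l. cost N e)"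
  unfolding min_path_cost_def using assms
  by (intro Min_le finite_imageI finite_subset[OF _ finite_routes]) (auto simp: routes_def)

end

section \<open>Decomposition of flows into paths and loops\<close>

locale decomposed_network = flow_network N for N :: "'v network" +
  fixes dec :: "'v decomposition"
  assumes dec: "decomposition_rule N dec"
begin

lemma dec_nonneg: "x \<in> feasible_flows N \<Longrightarrow> l \<in> routes N \<Longrightarrow> 0 \<le> dec x l"
  using dec by (simp add: decomposition_rule_def)

lemma dec_le:
  assumes "x \<in> feasible_flows N" "l \<in> routes N" "e \<in> l"
  shows "dec x l \<le> x e"
proof -
  have "dec x l \<le> (\<Sum>l | l \<in> routes N \<and> e \<in> l. dec x l)"
    using assms dec_nonneg finite_routes by (intro member_le_sum) auto
  also have "\<dots> = x e"
    using assms dec route_subset[OF assms(2)] by (auto simp: decomposition_rule_def)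
  finally show ?thesis .
qed

lemma route_flow_routes:
  assumes "x \<in> feasible_flows N"
  shows "route_flow (routes N) (dec x) = x"
proof
  fix e
  show "route_flow (routes N) (dec x) e = x e"
  proof (cases "e \<in> edges N")
    case True
    with assms dec show ?thesis by (simp add: decomposition_rule_def route_flow_def)
  next
    case False
    then have "route_flow (routes N) (dec x) e = 0"
      using route_subset by (blast intro: route_flow_zero)
    moreover have "x e = 0"
      using False assms unfolding feasible_flows_iff by blast
    ultimately show ?thesis by simp
  qed
qed

lemma route_flow_mono:
  assumes "x \<in> feasible_flows N" "A \<subseteq> B" "B \<subseteq> routes N"
  shows "route_flow A (dec x) e \<le> route_flow B (dec x) e"
  unfolding route_flow_def
  by (rule sum_mono2) (use assms dec_nonneg finite_subset[OF _ finite_routes] in auto)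

text \<open>Each route conserves flow by itself, and discarding routes of nonnegative weight can
  only lower the flow on an edge.\<close>

lemma route_flow_feasible:
  assumes x: "x \<in> feasible_flows N" and A: "A \<subseteq> routes N"
  shows "route_flow A (dec x) \<in> feasible_flows N"
  unfolding feasible_flows_iff
proof (intro conjI ballI allI impI)
  fix i assume "i \<in> vertices N - {source N, sink N}"
  then show "excess N (route_flow A (dec x)) i = 0"
    unfolding excess_route_flow[OF A] using A excess_route_inner
    by (intro sum.neutral) auto
next
  fix e assume "e \<in> edges N"
  have nonneg: "0 \<le> route_flow A (dec x) e" for e
    unfolding route_flow_def using x A dec_nonneg by (intro sum_nonneg) auto
  then show "0 \<le> route_flow A (dec x) e" .
  have "route_flow A (dec x) e \<le> x e" for e
    using route_flow_mono[OF x A, of e] by (simp add: route_flow_routes[OF x])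
  with x \<open>e \<in> edges N\<close> show "route_flow A (dec x) e \<le> capacity N e"
    by (meson feasible_flows_iff order_trans)
next
  fix e assume "e \<notin> edges N"
  then show "route_flow A (dec x) e = 0"
    using A route_subset by (blast intro: route_flow_zero)
qed

lemma flow_value_dec:
  assumes "x \<in> feasible_flows N"
  shows "flow_value N x = (\<Sum>l\<in>st_paths N. dec x l)"
  using flow_value_route_flow[of "routes N" "dec x"] st_path_route
  by (simp add: route_flow_routes[OF assms] Int_absorb1 subset_iff)

lemma transport_cost_dec:
  assumes "x \<in> feasible_flows N"
  shows "transport_cost N x = (\<Sum>l\<in>routes N. dec x l * (\<Sum>e\<in>l. cost N e))"
  using transport_cost_route_flow[of "routes N" "dec x"]
  by (simp add: route_flow_routes[OF assms])

lemma path_flow_cost: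
  assumes "x \<in> feasible_flows N" "l \<in> st_paths N"
  shows "min_path_cost N * dec x l \<le> dec x l * (\<Sum>e\<in>l. cost N e)"
proof -
  have "dec x l * min_path_cost N \<le> dec x l * (\<Sum>e\<in>l. cost N e)"
    using assms by (intro mult_left_mono min_path_cost_le dec_nonneg st_path_route)
  then show ?thesis
    by (simp only: mult.commute)
qed

text \<open>A unit sent along a path costs at least \<alpha>, and loops cost at least 0. This is the
  bound that keeps player 1 from a positive payoff.\<close>

lemma transport_cost_ge:
  assumes x: "x \<in> feasible_flows N"
  shows "min_path_cost N * flow_value N x \<le> transport_cost N x"
proof -
  have "min_path_cost N * flow_value N x \<le> (\<Sum>l\<in>st_paths N. dec x l * (\<Sum>e\<in>l. cost N e))"
    unfolding flow_value_dec[OF x] sum_distrib_left[where r = "min_path_cost N"]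
    by (intro sum_mono path_flow_cost[OF x]) simp
  also have "\<dots> \<le> transport_cost N x"
    unfolding transport_cost_dec[OF x]
    by (rule sum_mono2) (use x dec_nonneg st_path_route route_cost_nonneg finite_routes in auto)
  finally show ?thesis .
qed

text \<open>Dropping the loops of \<open>x\<close> leaves its value unchanged, so by optimality they are free.\<close>

lemma transport_cost_cheapest:
  assumes "cheapest_max_flow N dec x"
  shows "transport_cost N x = min_path_cost N * flow_value N x"
proof -
  have x: "x \<in> min_cost_max_flows N" "x \<in> max_flows N" "x \<in> feasible_flows N"
    using assms by (auto simp: cheapest_max_flow_def min_cost_max_flows_def max_flows_def)
  let ?y = "route_flow (st_paths N) (dec x)"
  have sub: "st_paths N \<subseteq> routes N"
    using st_path_route by blast
  have val: "flow_value N ?y = flow_value N x"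
    using flow_value_route_flow[OF sub] by (simp add: flow_value_dec[OF x(3)])
  have "?y \<in> max_flows N"
    using x(2) route_flow_feasible[OF x(3) sub] by (simp add: max_flows_def val)
  then have "transport_cost N x \<le> transport_cost N ?y"
    using x(1) by (simp add: min_cost_max_flows_def)
  also have "\<dots> = min_path_cost N * flow_value N x"
    unfolding transport_cost_route_flow[OF sub] flow_value_dec[OF x(3)]
      sum_distrib_left[where r = "min_path_cost N"]
  proof (rule sum.cong)
    fix l assume l: "l \<in> st_paths N"
    show "dec x l * (\<Sum>e\<in>l. cost N e) = min_path_cost N * dec x l"
    \<comment> \<open>Assumption 1 speaks only of paths that carry flow; on the others both sides
      are 0.\<close>
    proof (cases "dec x l > 0")
      case True
      with assms l show ?thesis by (simp add: cheapest_max_flow_def)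
    next
      case False
      with dec_nonneg[OF x(3) st_path_route[OF l]] show ?thesis by simp
    qed
  qed simp
  finally show ?thesis
    using transport_cost_ge[OF x(3)] by simp
qed

section \<open>Effective flows\<close>

definition intact_routes :: "'v attack \<Rightarrow> ('v \<times> 'v) set set" where
  "intact_routes m = {l \<in> routes N. \<forall>e\<in>l. m e = 0}"

lemma intact_routes_subset: "intact_routes m \<subseteq> routes N"
  by (auto simp: intact_routes_def)

lemma effective_flow_route_flow: "effective_flow N dec x m = route_flow (intact_routes m) (dec x)"
  by (simp add: effective_flow_def route_flow_def intact_routes_def conj_ac)

lemma effective_flow_feasible:
  "x \<in> feasible_flows N \<Longrightarrow> effective_flow N dec x m \<in> feasible_flows N"
  by (simp add: effective_flow_route_flow route_flow_feasible intact_routes_subset)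

lemma effective_flow_le:
  "x \<in> feasible_flows N \<Longrightarrow> effective_flow N dec x m e \<le> x e"
  using route_flow_mono[OF _ intact_routes_subset order_refl]
  by (metis effective_flow_route_flow route_flow_routes)

text \<open>The amount on a disrupted route is bounded by the flow on an attacked edge of that
  route, hence is 0.\<close>

lemma effective_flow_id:
  assumes "x \<in> feasible_flows N" "\<And>e. e \<in> edges N \<Longrightarrow> m e \<noteq> 0 \<Longrightarrow> x e = 0"
  shows "effective_flow N dec x m = x"
proof -
  have "dec x l = 0" if l: "l \<in> routes N" "e \<in> l" "m e \<noteq> 0" for l e
    using dec_le[OF assms(1) l(1,2)] dec_nonneg[OF assms(1) l(1)] assms(2)[of e] l route_subset
    by force
  then have "effective_flow N dec x m = route_flow (routes N) (dec x)"
    unfolding effective_flow_def route_flow_def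
    by (intro ext sum.mono_neutral_left) (auto intro: finite_subset[OF _ finite_routes])
  then show ?thesis
    by (simp add: route_flow_routes[OF assms(1)])
qed

lemma effective_flow_zero_attack:
  "x \<in> feasible_flows N \<Longrightarrow> effective_flow N dec x zero_attack = x"
  by (rule effective_flow_id) (auto simp: zero_attack_def)

lemma effective_flow_zero_flow: "effective_flow N dec zero_flow m = zero_flow"
  by (rule effective_flow_id) (auto simp: zero_flow_feasible, simp add: zero_flow_def)

text \<open>\<open>dec\<close> may split the effective flow differently from \<open>x\<close>, so
  nothing can be inherited from the decomposition of \<open>x\<close>. It suffices that the
  effective flow vanishes on attacked edges.\<close>

lemma effective_flow_idem:
  assumes "x \<in> feasible_flows N"
  shows "effective_flow N dec (effective_flow N dec x m) m = effective_flow N dec x m"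
proof (rule effective_flow_id[OF effective_flow_feasible[OF assms]])
  fix e assume "m e \<noteq> 0"
  then show "effective_flow N dec x m e = 0"
    unfolding effective_flow_route_flow by (intro route_flow_zero) (auto simp: intact_routes_def)
qed

lemma flow_value_effective:
  "flow_value N (effective_flow N dec x m) = (\<Sum>l\<in>intact_routes m \<inter> st_paths N. dec x l)"
  by (simp add: effective_flow_route_flow flow_value_route_flow intact_routes_subset)

lemma flow_value_effective_cut:
  assumes "st_cut N S T"
  shows "flow_value N (effective_flow N dec x (cut_attack N S)) = 0"
proof -
  have "intact_routes (cut_attack N S) \<inter> st_paths N = {}"
    using st_path_crosses_cut[OF _ assms] by (fastforce simp: intact_routes_def cut_attack_def)
  then show ?thesis
    by (simp add: flow_value_effective)
qed

lemma lost_flow: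
  assumes "x \<in> feasible_flows N"
  shows "flow_value N (\<lambda>e. x e - effective_flow N dec x m e) =
     flow_value N x - flow_value N (effective_flow N dec x m)"
    and "flow_value N x - flow_value N (effective_flow N dec x m) =
     (\<Sum>l\<in>st_paths N - intact_routes m. dec x l)"
proof -
  show "flow_value N (\<lambda>e. x e - effective_flow N dec x m e) =
     flow_value N x - flow_value N (effective_flow N dec x m)"
    by (simp add: flow_value_excess excess_diff)
  have "finite (st_paths N)"
    using st_path_route by (blast intro: finite_subset[OF _ finite_routes])
  then show "flow_value N x - flow_value N (effective_flow N dec x m) =
     (\<Sum>l\<in>st_paths N - intact_routes m. dec x l)"
    unfolding flow_value_dec[OF assms] flow_value_effective
    by (subst sum.Int_Diff[of _ _ "intact_routes m"]) (simp_all add: Int_commute)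
qed

text \<open>
  Every disrupted path contains an attacked edge, whose capacity bounds the total flow of the
  routes through it.
\<close>

lemma lost_flow_le_attack_cost:
  assumes x: "x \<in> feasible_flows N" and m: "m \<in> attacks N"
  shows "flow_value N x - flow_value N (effective_flow N dec x m) \<le> attack_cost N m"
proof -
  have "(\<Sum>l\<in>st_paths N - intact_routes m. dec x l)
      \<le> (\<Sum>l\<in>routes N. dec x l * (\<Sum>e\<in>edges N. real (m e) * indicator l e))"
  proof -
    have "(\<Sum>l\<in>st_paths N - intact_routes m. dec x l)
        \<le> (\<Sum>l\<in>st_paths N - intact_routes m. dec x l * (\<Sum>e\<in>edges N. real (m e) * indicator l e))"
    proof (rule sum_mono)
      fix l assume "l \<in> st_paths N - intact_routes m"
      then obtain e where l: "l \<in> routes N" and e: "e \<in> l" "m e \<noteq> 0"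
        using st_path_route by (auto simp: intact_routes_def)
      have "e \<in> edges N"
        using l e route_subset by blast
      have "1 \<le> real (m e) * indicator l e"
        using e by simp
      also have "\<dots> \<le> (\<Sum>e\<in>edges N. real (m e) * indicator l e)"
        using \<open>e \<in> edges N\<close> by (intro member_le_sum) auto
      finally show "dec x l \<le> dec x l * (\<Sum>e\<in>edges N. real (m e) * indicator l e)"
        using dec_nonneg[OF x l] by (simp add: mult_le_cancel_left1)
    qed
    also have "\<dots> \<le> (\<Sum>l\<in>routes N. dec x l * (\<Sum>e\<in>edges N. real (m e) * indicator l e))"
      by (rule sum_mono2)
        (use x dec_nonneg st_path_route finite_routes in \<open>auto intro!: mult_nonneg_nonneg sum_nonneg\<close>)
    finally show ?thesis .
  qed
  \<comment> \<open>Counting attacked edges on each route amounts to summing the flow over attacked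
    edges.\<close>
  also have "\<dots> = (\<Sum>e\<in>edges N. real (m e) * x e)"
    using sum_route_flow[of "routes N" "\<lambda>e. real (m e)" "dec x" "edges N"]
    by (simp add: route_flow_routes[OF x])
  also have "\<dots> \<le> attack_cost N m"
    unfolding attack_cost_def mult.commute[of "real _"] using x
    by (intro sum_mono mult_right_mono) (simp_all add: feasible_flows_iff del: split_paired_All)
  finally show ?thesis
    by (simp add: lost_flow(2)[OF x])
qed

lemma attack_cost_cut: "attack_cost N (cut_attack N S) = cut_capacity N S"
  unfolding attack_cost_def cut_capacity_def cut_attack_def
  by (rule sum.mono_neutral_cong_right) (use cut_set_subset in auto)

lemma cut_attack_attacks: "cut_attack N S \<in> attacks N"
  using cut_set_subset by (auto simp: attacks_def cut_attack_def indicator_def)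

lemma zero_attack_attacks: "zero_attack \<in> attacks N"
  by (simp add: attacks_def zero_attack_def)

lemma attack_cost_zero [simp]: "attack_cost N zero_attack = 0"
  by (simp add: attack_cost_def zero_attack_def)

lemma attack_cost_nonneg: "0 \<le> attack_cost N m"
  by (auto simp: attack_cost_def capacity_nonneg intro!: sum_nonneg)

lemma finite_attacks: "finite (attacks N)"
proof (rule finite_subset)
  show "attacks N \<subseteq> {f. \<forall>e. (e \<in> edges N \<longrightarrow> f e \<in> {0, 1}) \<and> (e \<notin> edges N \<longrightarrow> f e = 0)}"
    by (auto simp: attacks_def)
  show "finite {f :: 'v attack. \<forall>e. (e \<in> edges N \<longrightarrow> f e \<in> {0, 1}) \<and> (e \<notin> edges N \<longrightarrow> f e = 0)}"
    by (rule finite_set_of_finite_funs) auto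
qed

section \<open>Payoffs and equilibria\<close>

lemma payoff1_zero_flow [simp]: "payoff1 N dec p zero_flow m = 0"
  by (simp add: payoff1_def effective_flow_zero_flow)
    (simp add: zero_flow_def flow_value_def transport_cost_def)

lemma payoff2_zero_flow: "payoff2 N dec p zero_flow m = - attack_cost N m"
  by (simp add: payoff2_def effective_flow_zero_flow) (simp add: flow_value_def)

lemma expected_return_pmf [simp]: "expected (return_pmf x) (return_pmf m) \<phi> = \<phi> x m"
  by (simp add: expected_def)

lemma pure_equilibriumD:
  assumes "(return_pmf x, return_pmf m) \<in> nash_equilibria N dec p1 p2"
  shows "x \<in> feasible_flows N" "m \<in> attacks N"
    and "y \<in> feasible_flows N \<Longrightarrow> payoff1 N dec p1 y m \<le> payoff1 N dec p1 x m"
    and "\<nu> \<in> attacks N \<Longrightarrow> payoff2 N dec p2 x \<nu> \<le> payoff2 N dec p2 x m"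
proof -
  show "x \<in> feasible_flows N" "m \<in> attacks N"
    using assms by (auto simp: nash_equilibria_def mixed_flows_def mixed_attacks_def)
  show "payoff1 N dec p1 y m \<le> payoff1 N dec p1 x m" if "y \<in> feasible_flows N"
  proof -
    have "\<forall>\<tau>\<in>mixed_flows N. expected \<tau> (return_pmf m) (payoff1 N dec p1) \<le> payoff1 N dec p1 x m"
      using assms by (simp add: nash_equilibria_def)
    from bspec[OF this, of "return_pmf y"] that show ?thesis
      by (simp add: mixed_flows_def)
  qed
  show "payoff2 N dec p2 x \<nu> \<le> payoff2 N dec p2 x m" if "\<nu> \<in> attacks N"
  proof -
    have "\<forall>\<tau>\<in>mixed_attacks N. expected (return_pmf x) \<tau> (payoff2 N dec p2) \<le> payoff2 N dec p2 x m"
      using assms by (simp add: nash_equilibria_def)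
    from bspec[OF this, of "return_pmf \<nu>"] that show ?thesis
      by (simp add: mixed_attacks_def)
  qed
qed

text \<open>
  Player 1 would replace \<open>x\<close> by its effective flow, which has the same effective value and is
  cheaper as soon as some path of positive flow is disrupted.
\<close>

lemma best_flow_avoids_attack:
  assumes x: "x \<in> feasible_flows N" and \<alpha>: "min_path_cost N > 0"
    and best: "\<And>y. y \<in> feasible_flows N \<Longrightarrow> payoff1 N dec p y m \<le> payoff1 N dec p x m"
  shows "flow_value N (effective_flow N dec x m) = flow_value N x"
proof -
  let ?y = "effective_flow N dec x m" and ?b = "\<lambda>l. \<Sum>e\<in>l. cost N e"
  \<comment> \<open>By idempotence both flows have the same effective value, so only their costs are
    compared.\<close>
  have "transport_cost N x \<le> transport_cost N ?y"
    using best[OF effective_flow_feasible[OF x], of m] by (simp add: payoff1_def effective_flow_idem[OF x])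
  moreover have "transport_cost N x - transport_cost N ?y
      = (\<Sum>l\<in>routes N - intact_routes m. dec x l * ?b l)"
    unfolding transport_cost_dec[OF x] effective_flow_route_flow
      transport_cost_route_flow[OF intact_routes_subset]
    by (simp add: sum_diff finite_routes intact_routes_subset)
  moreover have "min_path_cost N * (flow_value N x - flow_value N ?y)
      \<le> (\<Sum>l\<in>st_paths N - intact_routes m. dec x l * ?b l)"
    unfolding lost_flow(2)[OF x] sum_distrib_left[where r = "min_path_cost N"]
    by (intro sum_mono path_flow_cost[OF x]) simp
  moreover have "(\<Sum>l\<in>st_paths N - intact_routes m. dec x l * ?b l)
      \<le> (\<Sum>l\<in>routes N - intact_routes m. dec x l * ?b l)"
    by (rule sum_mono2) (use x dec_nonneg st_path_route route_cost_nonneg finite_routes in auto)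
  ultimately have "min_path_cost N * (flow_value N x - flow_value N ?y) \<le> 0"
    by linarith
  then have "flow_value N x \<le> flow_value N ?y"
    using \<alpha> by (simp add: mult_le_0_iff)
  moreover have "flow_value N ?y \<le> flow_value N x"
    using effective_flow_le[OF x] unfolding flow_value_def by (intro sum_mono) auto
  ultimately show ?thesis by simp
qed

lemma no_pure_equilibrium:
  assumes pos: "\<exists>x\<in>feasible_flows N. flow_value N x > 0"
    and \<alpha>: "min_path_cost N > 0" "p1 > min_path_cost N" and p2: "p2 > 1"
    and xs: "cheapest_max_flow N dec xs"
  shows "(return_pmf x, return_pmf m) \<notin> nash_equilibria N dec p1 p2"
proof
  assume ne: "(return_pmf x, return_pmf m) \<in> nash_equilibria N dec p1 p2"
  note x = pure_equilibriumD(1)[OF ne] and m = pure_equilibriumD(2)[OF ne]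
    and best1 = pure_equilibriumD(3)[OF ne] and best2 = pure_equilibriumD(4)[OF ne]
  have xs': "xs \<in> max_flows N" "xs \<in> feasible_flows N"
    using xs by (auto simp: cheapest_max_flow_def min_cost_max_flows_def max_flows_def)
  have val: "flow_value N (effective_flow N dec x m) = flow_value N x"
    by (rule best_flow_avoids_attack[OF x \<alpha>(1) best1])
  \<comment> \<open>Since nothing is lost under \<open>m\<close>, not attacking would save its whole
    cost.\<close>
  have "attack_cost N m = 0"
    using best2[OF zero_attack_attacks] attack_cost_nonneg[of m] x
    by (simp add: payoff2_def lost_flow(1) val)
      (simp add: flow_value_def effective_flow_zero_attack)
  \<comment> \<open>A free attack may still hit edges of capacity 0, but no feasible flow uses
    them.\<close>
  then have "capacity N e = 0" if "e \<in> edges N" "m e \<noteq> 0" for e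
    using that by (auto simp: attack_cost_def sum_nonneg_eq_0_iff capacity_nonneg)
  then have harmless: "effective_flow N dec y m = y" if "y \<in> feasible_flows N" for y
    using that by (intro effective_flow_id) (force simp: feasible_flows_iff)+
  \<comment> \<open>Deviation of player 1 to \<open>xs\<close>, which the harmless attack leaves
    intact.\<close>
  have "p1 * flow_value N xs - transport_cost N xs \<le> p1 * flow_value N x - transport_cost N x"
    using best1[OF xs'(2)] by (simp add: payoff1_def harmless x xs'(2))
  then have "(p1 - min_path_cost N) * flow_value N xs \<le> (p1 - min_path_cost N) * flow_value N x"
    using transport_cost_ge[OF x] by (simp add: transport_cost_cheapest[OF xs] left_diff_distrib)
  then have ge: "flow_value N xs \<le> flow_value N x"
    using \<alpha>(2) by simp
  obtain S T where cut: "min_cut N S T"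
    using min_cut_exists[OF xs'(1)] by blast
  \<comment> \<open>Deviation of player 2 to a minimum cut: all of \<open>x\<close> is lost, at a
    cost equal to the maximum flow value.\<close>
  have "p2 * flow_value N x - flow_value N xs \<le> 0"
    using best2[OF cut_attack_attacks[of S]] \<open>attack_cost N m = 0\<close> x
    by (simp add: payoff2_def lost_flow(1) val attack_cost_cut min_cut_capacity[OF xs'(1) cut]
        flow_value_effective_cut[where S = S and T = T] cut[unfolded min_cut_def, THEN conjunct1])
  moreover have "0 < flow_value N xs"
    using pos xs'(1) by (force simp: max_flows_def)
  then have "flow_value N xs < p2 * flow_value N x"
    using ge p2 by (smt (verit) mult_less_cancel_right1)
  ultimately show False by simp
qed

text \<open>The flow arrives in full with probability \<open>q\<close> and not at all otherwise. The
  choice of \<open>q\<close> makes the expected revenue per unit equal to \<alpha>, the cost of a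
  cheapest path.\<close>

lemma expected_payoff1_cut:
  assumes x: "x \<in> feasible_flows N" and cut: "st_cut N S T"
    and "0 \<le> q" "q \<le> 1" "p1 > 0" "q * p1 = min_path_cost N"
  shows "measure_pmf.expectation (two_point_pmf q zero_attack (cut_attack N S)) (payoff1 N dec p1 x) =
     min_path_cost N * flow_value N x - transport_cost N x"
proof -
  have "measure_pmf.expectation (two_point_pmf q zero_attack (cut_attack N S)) (payoff1 N dec p1 x) =
      q * (p1 * flow_value N x - transport_cost N x) + (1 - q) * (- transport_cost N x)"
    using assms by (simp add: expectation_two_point_pmf payoff1_def effective_flow_zero_attack
        flow_value_effective_cut[OF cut])
  also have "\<dots> = (q * p1) * flow_value N x - transport_cost N x"
    by (simp add: algebra_simps)
  finally show ?thesis by (simp add: assms)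
qed

text \<open>Against the prescribed opponent no strategy earns more than 0, and the prescribed one
  earns exactly 0. The two inequalities between actions serve to read off the point
  probabilities.\<close>

lemma mixed_equilibrium:
  assumes pos: "\<exists>x\<in>feasible_flows N. flow_value N x > 0"
    and \<alpha>: "min_path_cost N > 0" "p1 > min_path_cost N" and p2: "p2 > 1"
    and xs: "cheapest_max_flow N dec x" and cut: "min_cut N S T"
  defines "\<sigma>1 \<equiv> two_point_pmf (1 / p2) x zero_flow"
    and "\<sigma>2 \<equiv> two_point_pmf (min_path_cost N / p1) zero_attack (cut_attack N S)"
  shows "(\<sigma>1, \<sigma>2) \<in> nash_equilibria N dec p1 p2"
    and "expected \<sigma>1 \<sigma>2 (payoff1 N dec p1) = 0"
    and "expected \<sigma>1 \<sigma>2 (payoff2 N dec p2) = 0"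
    and "x \<noteq> zero_flow" "zero_attack \<noteq> cut_attack N S"
proof -
  let ?\<alpha> = "min_path_cost N"
  have x: "x \<in> max_flows N" "x \<in> feasible_flows N"
    using xs by (auto simp: cheapest_max_flow_def min_cost_max_flows_def max_flows_def)
  have st: "st_cut N S T"
    using cut by (simp add: min_cut_def)
  have cap: "cut_capacity N S = flow_value N x"
    by (rule min_cut_capacity[OF x(1) cut])
  have Fpos: "flow_value N x > 0"
    using pos x(1) by (force simp: max_flows_def)
  then show "x \<noteq> zero_flow"
    by (auto simp: zero_flow_def flow_value_def)
  show "zero_attack \<noteq> cut_attack N S"
    using Fpos attack_cost_cut[of S] cap by (metis attack_cost_zero less_irrefl)
  have q1: "0 < 1 / p2" "1 / p2 < 1" and q2: "0 < ?\<alpha> / p1" "?\<alpha> / p1 < 1"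
    using \<alpha> p2 by auto
  have s1: "set_pmf \<sigma>1 \<subseteq> feasible_flows N"
    using q1 x zero_flow_feasible by (simp add: \<sigma>1_def set_two_point_pmf)
  have s2: "set_pmf \<sigma>2 \<subseteq> attacks N"
    using q2 zero_attack_attacks cut_attack_attacks by (simp add: \<sigma>2_def set_two_point_pmf)
  have U1: "measure_pmf.expectation \<sigma>2 (payoff1 N dec p1 y) = ?\<alpha> * flow_value N y - transport_cost N y"
    if "y \<in> feasible_flows N" for y
    unfolding \<sigma>2_def using q2 \<alpha> by (intro expected_payoff1_cut[OF that st]) auto
  \<comment> \<open>The weight \<open>1 / p2\<close> of \<open>x\<close> cancels the factor
    \<open>p2\<close> of the lost flow, while the attack cost is paid against either flow.\<close>
  have U2: "expected \<sigma>1 \<tau> (payoff2 N dec p2) = measure_pmf.expectation \<tau>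
      (\<lambda>m. flow_value N x - flow_value N (effective_flow N dec x m) - attack_cost N m)"
    if "set_pmf \<tau> \<subseteq> attacks N" for \<tau>
  proof -
    \<comment> \<open>Integrability allows the expectations against the two flows to be merged into
      one.\<close>
    have int: "integrable (measure_pmf \<tau>) f" for f :: "'v attack \<Rightarrow> real"
      using that finite_attacks by (intro integrable_measure_pmf_finite) (rule finite_subset)
    have "expected \<sigma>1 \<tau> (payoff2 N dec p2) = measure_pmf.expectation \<tau>
        (\<lambda>m. 1 / p2 * payoff2 N dec p2 x m + (1 - 1 / p2) * payoff2 N dec p2 zero_flow m)"
      using q1 by (simp add: expected_def \<sigma>1_def expectation_two_point_pmf int)
    also have "\<dots> = measure_pmf.expectation \<tau>
      (\<lambda>m. flow_value N x - flow_value N (effective_flow N dec x m) - attack_cost N m)"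
      using p2 unfolding payoff2_zero_flow
      by (intro Bochner_Integration.integral_cong)
        (simp_all add: payoff2_def lost_flow(1)[OF x(2)] field_simps)
    finally show ?thesis .
  qed
  have "measure_pmf.expectation \<sigma>2 (payoff1 N dec p1 x) = 0"
    using U1[OF x(2)] transport_cost_cheapest[OF xs] by simp
  then show U1_zero: "expected \<sigma>1 \<sigma>2 (payoff1 N dec p1) = 0"
    using q1 U1[OF zero_flow_feasible]
    by (simp add: expected_def \<sigma>1_def expectation_two_point_pmf payoff1_zero_flow[abs_def])
  \<comment> \<open>Both terms will vanish: no attack loses nothing for free, and the cut loses the
    full value at a cost equal to it.\<close>
  have U2_eq: "expected \<sigma>1 \<sigma>2 (payoff2 N dec p2) =
      ?\<alpha> / p1 * (flow_value N x - flow_value N (effective_flow N dec x zero_attack) - attack_cost N zero_attack)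
      + (1 - ?\<alpha> / p1) * (flow_value N x - flow_value N (effective_flow N dec x (cut_attack N S))
        - attack_cost N (cut_attack N S))"
    unfolding U2[OF s2] unfolding \<sigma>2_def using q2 by (intro expectation_two_point_pmf) auto
  show U2_zero: "expected \<sigma>1 \<sigma>2 (payoff2 N dec p2) = 0"
    unfolding U2_eq by (simp add: effective_flow_zero_attack[OF x(2)] flow_value_effective_cut[OF st]
        attack_cost_cut cap)
  have "expected \<tau> \<sigma>2 (payoff1 N dec p1) \<le> 0" if "\<tau> \<in> mixed_flows N" for \<tau>
  proof -
    \<comment> \<open>Nonnegativity of the negated integrand bounds the integral without an
      integrability argument for \<tau>, whose support may be infinite.\<close>
    have "AE y in measure_pmf \<tau>. 0 \<le> - measure_pmf.expectation \<sigma>2 (payoff1 N dec p1 y)"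
      using that U1 transport_cost_ge by (auto simp: AE_measure_pmf_iff mixed_flows_def subset_iff)
    from integral_nonneg_AE[OF this] show ?thesis
      by (simp add: expected_def)
  qed
  moreover have "expected \<sigma>1 \<tau> (payoff2 N dec p2) \<le> 0" if "\<tau> \<in> mixed_attacks N" for \<tau>
  proof -
    have \<tau>: "set_pmf \<tau> \<subseteq> attacks N"
      using that by (simp add: mixed_attacks_def)
    have "AE m in measure_pmf \<tau>.
        0 \<le> - (flow_value N x - flow_value N (effective_flow N dec x m) - attack_cost N m)"
      using \<tau> lost_flow_le_attack_cost[OF x(2)] by (auto simp: AE_measure_pmf_iff subset_iff)
    from integral_nonneg_AE[OF this] show ?thesis
      unfolding U2[OF \<tau>] by (simp del: minus_diff_eq)
  qed
  ultimately show "(\<sigma>1, \<sigma>2) \<in> nash_equilibria N dec p1 p2"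
    using s1 s2 U1_zero U2_zero by (simp add: nash_equilibria_def mixed_flows_def mixed_attacks_def)
qed

end

theorem proposition3:
  fixes N :: "'v network" and dec :: "'v decomposition" and p1 p2 :: real
  assumes "network N"
    and "decomposition_rule N dec"
    and "\<exists>x\<in>feasible_flows N. flow_value N x > 0"
    and "min_path_cost N > 0"
    and "\<exists>x. cheapest_max_flow N dec x"
    and "p1 > min_path_cost N"
    and "p2 > 1"
  shows "\<not> (\<exists>x \<mu>. (return_pmf x, return_pmf \<mu>) \<in> nash_equilibria N dec p1 p2) \<and>
    (\<exists>S T. min_cut N S T) \<and>
    (\<forall>x S T. cheapest_max_flow N dec x \<and> min_cut N S T \<longrightarrow>
      (\<exists>\<sigma>1 \<sigma>2. (\<sigma>1, \<sigma>2) \<in> nash_equilibria N dec p1 p2 \<and>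
         expected \<sigma>1 \<sigma>2 (payoff1 N dec p1) = 0 \<and>
         expected \<sigma>1 \<sigma>2 (payoff2 N dec p2) = 0 \<and>
         set_pmf \<sigma>1 = {zero_flow, x} \<and>
         set_pmf \<sigma>2 = {zero_attack, cut_attack N S} \<and>
         pmf \<sigma>1 zero_flow = 1 - 1 / p2 \<and>
         pmf \<sigma>1 x = 1 / p2 \<and>
         pmf \<sigma>2 zero_attack = min_path_cost N / p1 \<and>
         pmf \<sigma>2 (cut_attack N S) = 1 - min_path_cost N / p1))"
proof -
  interpret decomposed_network N dec
    using assms(1,2) by unfold_locales
  obtain y where y: "cheapest_max_flow N dec y"
    using assms(5) by blast
  then have "y \<in> max_flows N"
    by (simp add: cheapest_max_flow_def min_cost_max_flows_def)
  \<comment> \<open>Strict bounds ensure that both actions of each mixture belong to its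
    support.\<close>
  have q: "0 < 1 / p2" "1 / p2 < 1" "0 < min_path_cost N / p1" "min_path_cost N / p1 < 1"
    using assms(4,6,7) by auto
  show ?thesis
  proof (intro conjI allI impI; (elim conjE)?)
    show "\<not> (\<exists>x a. (return_pmf x, return_pmf a) \<in> nash_equilibria N dec p1 p2)"
      using no_pure_equilibrium[OF assms(3,4,6,7) y] by blast
    show "\<exists>S T. min_cut N S T"
      using min_cut_exists[OF \<open>y \<in> max_flows N\<close>] .
  next
    fix x S T assume "cheapest_max_flow N dec x" "min_cut N S T"
    note eq = mixed_equilibrium[OF assms(3,4,6,7) this]
    show "\<exists>\<sigma>1 \<sigma>2. (\<sigma>1, \<sigma>2) \<in> nash_equilibria N dec p1 p2 \<and>
         expected \<sigma>1 \<sigma>2 (payoff1 N dec p1) = 0 \<and>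
         expected \<sigma>1 \<sigma>2 (payoff2 N dec p2) = 0 \<and>
         set_pmf \<sigma>1 = {zero_flow, x} \<and>
         set_pmf \<sigma>2 = {zero_attack, cut_attack N S} \<and>
         pmf \<sigma>1 zero_flow = 1 - 1 / p2 \<and>
         pmf \<sigma>1 x = 1 / p2 \<and>
         pmf \<sigma>2 zero_attack = min_path_cost N / p1 \<and>
         pmf \<sigma>2 (cut_attack N S) = 1 - min_path_cost N / p1"
      using eq(1-3) eq(4,5) q
      by (intro exI[of _ "two_point_pmf (1 / p2) x zero_flow"]
          exI[of _ "two_point_pmf (min_path_cost N / p1) zero_attack (cut_attack N S)"])
        (simp add: set_two_point_pmf pmf_two_point_pmf insert_commute del: One_nat_def)
  qed
qed

end
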